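(* Let $G=(X,\Sigma,\delta,X_0)$ be a non-deterministic finite-state automaton with $\Sigma=\Sigma_o\,\dot\cup\,\Sigma_{uo}$, let $\Gamma\subseteq\Sigma_o$ be a set of anonymous events with $|\Gamma|\ge 2$, let $P_w$ be the weak anonymous projection, let $\widehat{Obs}(\widehat G)$ be the observer of the augmented automaton $\widehat G$, and let $Cc(\widehat G_w,Obs_w(\widehat G))=(X_c^w,\Sigma_c^w,\delta_c^w,X_{0,c}^w)$ be the concurrent composition of $\widehat G_w$ and the variant observer $Obs_w(\widehat G)$. Then: (i) $G$ is infinite-step weakly anonymous w.r.t. $\Sigma_o$, $\Gamma$ and $P_w$ if and only if no state of the form $(\cdot,\emptyset)$ in $Cc(\widehat G_w,Obs_w(\widehat G))$ is reachable from $X_{0,c}^w$; (ii) for every $K\in\mathbb{N}$, $G$ is $K$-step weakly anonymous w.r.t. $\Sigma_o$, $\Gamma$ and $P_w$ if and only if no state of the form $(\cdot,\emptyset)$ in $Cc(\widehat G_w,Obs_w(\widehat G))$ is reachable from $X_{0,c}^w$ within $K$ observational steps.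
   Context: $\mathbb{N}$ is the set of non-negative integers and $\epsilon$ the empty string. A non-deterministic finite-state automaton (NFA) is $G=(X,\Sigma,\delta,X_0)$ with finite state set $X$, finite event set $\Sigma$, transition function $\delta:X\times\Sigma\to 2^X$ (extended to $X\times\Sigma^*$ in the usual way, with $\delta(x,\epsilon)=\{x\}$), and initial states $X_0\subseteq X$. $\mathcal{L}(G,x)=\{s\in\Sigma^*\mid\delta(x,s)\ne\emptyset\}$ and $\mathcal{L}(G)=\bigcup_{x_0\in X_0}\mathcal{L}(G,x_0)$. $\Sigma_o$ and $\Sigma_{uo}$ are the observable and unobservable events. Weak anonymous projection: let $\Gamma_w=\{\gamma_1,\dots,\gamma_{|\Gamma|}\}$ be a set of distinct labels, disjoint from $\Sigma_o$. For a string $\mu$, $E_\Gamma(\mu)$ is the set of events of $\Gamma$ appearing in $\mu$. For $\sigma\in\Gamma$ and a string $s=\mu\sigma v$ with $\mu\in(\Sigma\setminus\{\sigma\})^*$ and $v\in\Sigma^*$, put $R(s,\sigma)=|E_\Gamma(\mu)|+1$. $P_w:\Sigma^*\to(\Sigma_o\cup\Gamma_w)^*$ is given by $P_w(\epsilon)=\epsilon$ and $P_w(s\sigma)=P_w(s)\gamma_{R(s\sigma,\sigma)}$ if $\sigma\in\Gamma$; $=P_w(s)\sigma$ if $\sigma\in\Sigma_o\setminus\Gamma$; $=P_w(s)$ if $\sigma\in\Sigma_{uo}$. Delayed state estimate, for $\alpha\beta\in P_w(\mathcal{L}(G))$: $$\widehat{E}_G(P_w,\alpha|\alpha\beta)=\{x\in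 X\mid\exists x_0\in X_0,\exists s\in\mathcal{L}(G,x_0),\exists t\in\mathcal{L}(G,x): P_w(s)=\alpha\wedge x\in\delta(x_0,s)\wedge P_w(st)=\alpha\beta\}.$$ $G$ is $K$-step weakly anonymous w.r.t. $\Sigma_o,\Gamma,P_w$ if for all $st\in\mathcal{L}(G)$ with $P_w(s)=\alpha$, $P_w(st)=\alpha\beta$ and $|\beta|\le K$, one has $|\widehat{E}_G(P_w,\alpha|\alpha\beta)|>1$. It is infinite-step weakly anonymous if this holds with no restriction on $|\beta|$. Augmented automaton: let $\widehat\Gamma=\{\sigma_i\mid\sigma\in\Gamma,1\le i\le|\Gamma|\}$ (indexed copies of the events of $\Gamma$). A history is a set $\{(\sigma^1)_1,\dots,(\sigma^i)_i\}\subseteq\widehat\Gamma$ with $0\le i\le|\Gamma|$ and $\sigma^1,\dots,\sigma^i\in\Gamma$ distinct; for $i=0$ it is written $\epsilon$. $\widehat G=(\widehat X,\widehat\Sigma,\widehat\delta,\widehat X_0)$, where $\widehat X$ is the set of pairs $(x,p)$ with $x\in X$ and $p$ a history; $\widehat\Sigma=\widehat\Gamma\cup(\Sigma_o\setminus\Gamma)\cup\Sigma_{uo}$, with observable events $\widehat\Gamma\cup(\Sigma_o\setminus\Gamma)$ and unobservable events $\Sigma_{uo}$; $\widehat X_0=X_0\times\{\epsilon\}$; and $\widehat\delta:\widehat X\times\widehat\Sigma\to 2^{\widehat X}$ is given by: (1) $\widehat\delta((x,p),e)=\{(x',p)\mid x'\in\delta(x,e)\}$ for $e\in(\Sigma_o\setminus\Gamma)\cup\Sigma_{uo}$;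 (2) if $p=\{(\sigma^1)_1,\dots,(\sigma^i)_i\}$ and $1\le j\le i$, $\widehat\delta((x,p),(\sigma^j)_j)=\{(x',p)\mid x'\in\delta(x,\sigma^j)\}$; (3) if $p=\{(\sigma^1)_1,\dots,(\sigma^i)_i\}$ and $\sigma^{i+1}\in\Gamma$ is distinct from $\sigma^1,\dots,\sigma^i$, $\widehat\delta((x,p),(\sigma^{i+1})_{i+1})=\{(x',p\cup\{(\sigma^{i+1})_{i+1}\})\mid x'\in\delta(x,\sigma^{i+1})\}$; (4) no other transitions exist. Let $P^m(\sigma_i)=\gamma_i$ for $\sigma_i\in\widehat\Gamma$. $P^n:\widehat\Sigma^*\to(\Gamma_w\cup(\Sigma_o\setminus\Gamma))^*$ is the letterwise extension of $\sigma\mapsto P^m(\sigma)$ on $\widehat\Gamma$, $\sigma\mapsto\sigma$ on $\Sigma_o\setminus\Gamma$, $\sigma\mapsto\epsilon$ on $\Sigma_{uo}$. For $Q\subseteq\widehat X$, $UR_w(Q)=\{q'\in\widehat X\mid\exists q\in Q,\exists s\in\Sigma_{uo}^*:q'\in\widehat\delta(q,s)\}$. Observer: $\widehat{Obs}(\widehat G)$ is the deterministic automaton with state set $2^{\widehat X}$, event set $\Gamma_w\cup(\Sigma_o\setminus\Gamma)$, initial state $UR_w(\widehat X_0)$, and total transition function sending $(q,\sigma)$ to $UR_w(\{\widehat x'\mid\exists\widehat x\in q:\widehat x'\in\widehat\delta(\widehat x,\sigma)\})$ if $\sigma\in\Sigma_o\setminus\Gamma$ and to $UR_w(\{\widehat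 x'\mid\exists\widehat x\in q,\exists\widehat\sigma'\in\widehat\Gamma:\widehat x'\in\widehat\delta(\widehat x,\widehat\sigma')\wedge P^m(\widehat\sigma')=\sigma\})$ if $\sigma\in\Gamma_w$. Let $\widetilde X_{obs}$ be the set of its states reachable from the initial state. Adjoint state set: for $\widehat x=(x,p)\in\widehat x_{obs}\subseteq\widehat X$, let $m(\widehat x_{obs})=\{y\in X\mid(y,p')\in\widehat x_{obs}\text{ for some }p'\}$ and $n(\widehat x,\widehat x_{obs})=\{(y,p')\in\widehat x_{obs}\mid y=x\}$. Then $AS_w(\widehat x,\widehat x_{obs})=UR_w(\widehat x_{obs}\setminus n(\widehat x,\widehat x_{obs}))$ if $|m(\widehat x_{obs})|>1$, and $AS_w(\widehat x,\widehat x_{obs})=\emptyset$ if $|m(\widehat x_{obs})|=1$. Variant observer: $Obs_w(\widehat G)$ has the same states, events and transition function (written $\delta_w$) as $\widehat{Obs}(\widehat G)$, but set of initial states $X_{0,w}=\{AS_w(\widehat x,\widehat x_{obs})\mid\widehat x\in\widehat x_{obs},\ \emptyset\ne\widehat x_{obs}\in\widetilde X_{obs}\}$. $\widehat G_w$ is $\widehat G$ with all states declared initial. Concurrent composition: $Cc(\widehat G_w,Obs_w(\widehat G))=(X_c^w,\Sigma_c^w,\delta_c^w,X_{0,c}^w)$, where $X_c^w=\widehat X\times 2^{\widehat X}$; $\Sigma_c^w=\{(\sigma,P^n(\sigma))\mid\sigma\in\widehat\Gamma\cup(\Sigma_o\setminus\Gamma)\}\cup\{(\sigma,\epsilon)\mid\sigma\in\Sigma_{uo}\}$;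 for observable $\sigma$, $(\widehat x',q')\in\delta_c^w((\widehat x,q),(\sigma,P^n(\sigma)))$ iff $\widehat x'\in\widehat\delta(\widehat x,\sigma)$ and $q'=\delta_w(q,P^n(\sigma))$; for $\sigma\in\Sigma_{uo}$, $(\widehat x',q')\in\delta_c^w((\widehat x,q),(\sigma,\epsilon))$ iff $\widehat x'\in\widehat\delta(\widehat x,\sigma)$ and $q'=q$; and $X_{0,c}^w=\{(\widehat x,AS_w(\widehat x,\widehat x_{obs}))\mid\widehat x\in\widehat x_{obs},\ \emptyset\ne\widehat x_{obs}\in\widetilde X_{obs}\}$. For a string $s_c$ over $\Sigma_c^w$, $R(s_c)$ is the concatenation of the second components of its letters. A state is reachable from $X_{0,c}^w$ within $K$ observational steps if it belongs to $\delta_c^w(x_0,s_c)$ for some $x_0\in X_{0,c}^w$ and some string $s_c$ (possibly empty) with $|R(s_c)|\le K$. "Of the form $(\cdot,\emptyset)$" means that the second component is the empty set. *)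

theory Defs
  imports Main
begin

section \<open>Automata\<close>

record ('q, 'a) nfa =
  states :: "'q set"
  events :: "'a set"
  delta :: "'q \<Rightarrow> 'a \<Rightarrow> 'q set"
  inits :: "'q set"

definition finite_nfa :: "('q, 'a) nfa \<Rightarrow> bool" where
  "finite_nfa A \<longleftrightarrow>
     finite (states A) \<and> finite (events A) \<and> inits A \<subseteq> states A \<and>
     (\<forall>q \<in> states A. \<forall>a \<in> events A. delta A q a \<subseteq> states A)"

primrec delta_star :: "('q, 'a) nfa \<Rightarrow> 'q \<Rightarrow> 'a list \<Rightarrow> 'q set" where
  "delta_star A q [] = {q}"
| "delta_star A q (a # s) = (\<Union>q' \<in> delta A q a. delta_star A q' s)"

definition lang_from :: "('q, 'a) nfa \<Rightarrow> 'q \<Rightarrow> 'a list set" where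
  "lang_from A q = {s \<in> lists (events A). delta_star A q s \<noteq> {}}"

definition lang :: "('q, 'a) nfa \<Rightarrow> 'a list set" where
  "lang A = (\<Union>q \<in> inits A. lang_from A q)"

text \<open>Deterministic automata with a total transition function, possibly with several
  initial states. The transition function is meaningful on \<open>dstates\<close> and \<open>devents\<close> only.\<close>

record ('q, 'a) det =
  dstates :: "'q set"
  devents :: "'a set"
  dtrans :: "'q \<Rightarrow> 'a \<Rightarrow> 'q"
  dinits :: "'q set"

definition dreachable :: "('q, 'a) det \<Rightarrow> 'q set" where
  "dreachable D = {foldl (dtrans D) q s | q s. q \<in> dinits D \<and> s \<in> lists (devents D)}"


section \<open>Alphabets\<close>

text \<open>Output symbols: the label \<open>\<gamma>\<^sub>i\<close> is \<open>Lab i\<close>. Labels are pairwise distinct and disjoint from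
  the observable events by construction.\<close>

datatype 'e out = Lab nat | Ev 'e

text \<open>Events of the augmented automaton: the indexed copy \<open>\<sigma>\<^sub>i\<close> of an anonymous event is
  \<open>Idx \<sigma> i\<close>; all other events are kept as \<open>Plain \<sigma>\<close>.\<close>

datatype 'e aug = Idx 'e nat | Plain 'e

fun Pm :: "'e aug \<Rightarrow> 'e out" where
  "Pm (Idx \<sigma> i) = Lab i"

text \<open>The history \<open>{(\<sigma>\<^sup>1)\<^sub>1, \<dots>, (\<sigma>\<^sup>i)\<^sub>i}\<close> of the sequence \<open>\<sigma>\<^sup>1, \<dots>, \<sigma>\<^sup>i\<close>; indices start at 1.\<close>

definition history :: "'e list \<Rightarrow> 'e aug set" where
  "history l = {Idx (l ! k) (Suc k) | k. k < length l}"

type_synonym ('x, 'e) aug_state = "'x \<times> 'e aug set"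


section \<open>Weak anonymity and its verification structure\<close>

locale weak_anonymity =
  fixes G :: "('x, 'e) nfa" and Eo Euo \<Gamma> :: "'e set"
begin

subsection \<open>Weak anonymous projection\<close>

text \<open>\<open>rank s \<sigma>\<close> is \<open>R(s, \<sigma>)\<close>: the events counted are those of \<open>\<mu>\<close> in \<open>s = \<mu> \<sigma> v\<close>, where \<open>\<mu>\<close> does
  not contain \<open>\<sigma>\<close>. In \<open>Pw\<close> the last branch is the unobservable case, as \<open>\<Gamma> \<subseteq> Eo\<close> and all
  strings are over \<open>Eo \<union> Euo\<close>.\<close>

definition rank :: "'e list \<Rightarrow> 'e \<Rightarrow> nat" where
  "rank s \<sigma> = card (set (takeWhile (\<lambda>\<tau>. \<tau> \<noteq> \<sigma>) s) \<inter> \<Gamma>) + 1"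

function Pw :: "'e list \<Rightarrow> 'e out list" where
  "Pw [] = []"
| "Pw (s @ [\<sigma>]) =
     (if \<sigma> \<in> \<Gamma> then Pw s @ [Lab (rank (s @ [\<sigma>]) \<sigma>)]
      else if \<sigma> \<in> Eo then Pw s @ [Ev \<sigma>]
      else Pw s)"
proof -
  fix P :: bool and s :: "'e list"
  assume "s = [] \<Longrightarrow> P" "\<And>s' \<sigma>. s = s' @ [\<sigma>] \<Longrightarrow> P"
  then show P by (cases s rule: rev_cases)
qed auto
termination by (relation "measure length") auto

definition delayed_estimate :: "'e out list \<Rightarrow> 'e out list \<Rightarrow> 'x set" where
  "delayed_estimate \<alpha> \<beta> =
     {x \<in> states G. \<exists>x0 \<in> inits G. \<exists>s \<in> lang_from G x0. \<exists>t \<in> lang_from G x.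
        Pw s = \<alpha> \<and> x \<in> delta_star G x0 s \<and> Pw (s @ t) = \<alpha> @ \<beta>}"

definition K_step_weakly_anonymous :: "nat \<Rightarrow> bool" where
  "K_step_weakly_anonymous K \<longleftrightarrow>
     (\<forall>s t \<alpha> \<beta>. s @ t \<in> lang G \<and> Pw s = \<alpha> \<and> Pw (s @ t) = \<alpha> @ \<beta> \<and> length \<beta> \<le> K
        \<longrightarrow> card (delayed_estimate \<alpha> \<beta>) > 1)"

definition infinite_step_weakly_anonymous :: bool where
  "infinite_step_weakly_anonymous \<longleftrightarrow>
     (\<forall>s t \<alpha> \<beta>. s @ t \<in> lang G \<and> Pw s = \<alpha> \<and> Pw (s @ t) = \<alpha> @ \<beta>
        \<longrightarrow> card (delayed_estimate \<alpha> \<beta>) > 1)"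


subsection \<open>Augmented automaton\<close>

definition Gw :: "'e out set" where
  "Gw = Lab ` {1..card \<Gamma>}"

definition Gamma_hat :: "'e aug set" where
  "Gamma_hat = {Idx \<sigma> i | \<sigma> i. \<sigma> \<in> \<Gamma> \<and> 1 \<le> i \<and> i \<le> card \<Gamma>}"

definition histories :: "'e aug set set" where
  "histories = {history l | l. distinct l \<and> set l \<subseteq> \<Gamma>}"

definition X_hat :: "('x, 'e) aug_state set" where
  "X_hat = states G \<times> histories"

inductive aug_step :: "('x, 'e) aug_state \<Rightarrow> 'e aug \<Rightarrow> ('x, 'e) aug_state \<Rightarrow> bool" where
  plain: "\<lbrakk>x \<in> states G; p \<in> histories; e \<in> (Eo - \<Gamma>) \<union> Euo; x' \<in> delta G x e\<rbrakk>
    \<Longrightarrow> aug_step (x, p) (Plain e) (x', p)"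
| seen: "\<lbrakk>x \<in> states G; distinct l; set l \<subseteq> \<Gamma>; k < length l; x' \<in> delta G x (l ! k)\<rbrakk>
    \<Longrightarrow> aug_step (x, history l) (Idx (l ! k) (Suc k)) (x', history l)"
| fresh: "\<lbrakk>x \<in> states G; distinct l; set l \<subseteq> \<Gamma>; \<sigma> \<in> \<Gamma>; \<sigma> \<notin> set l; x' \<in> delta G x \<sigma>\<rbrakk>
    \<Longrightarrow> aug_step (x, history l) (Idx \<sigma> (Suc (length l)))
          (x', history l \<union> {Idx \<sigma> (Suc (length l))})"

definition G_hat :: "(('x, 'e) aug_state, 'e aug) nfa" where
  "G_hat = \<lparr>states = X_hat,
            events = Gamma_hat \<union> Plain ` ((Eo - \<Gamma>) \<union> Euo),
            delta = (\<lambda>q a. {q'. aug_step q a q'}),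
            inits = inits G \<times> {{}}\<rparr>"

definition G_hat_w :: "(('x, 'e) aug_state, 'e aug) nfa" where
  "G_hat_w = G_hat\<lparr>inits := states G_hat\<rparr>"

primrec Pn_letter :: "'e aug \<Rightarrow> 'e out list" where
  "Pn_letter (Idx \<sigma> i) = [Pm (Idx \<sigma> i)]"
| "Pn_letter (Plain \<sigma>) = (if \<sigma> \<in> Eo - \<Gamma> then [Ev \<sigma>] else [])"

definition Pn :: "'e aug list \<Rightarrow> 'e out list" where
  "Pn s = concat (map Pn_letter s)"


subsection \<open>Observers\<close>

definition URw :: "('x, 'e) aug_state set \<Rightarrow> ('x, 'e) aug_state set" where
  "URw Q = {q' \<in> X_hat. \<exists>q \<in> Q. \<exists>s \<in> lists (Plain ` Euo). q' \<in> delta_star G_hat q s}"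

primrec obs_trans :: "('x, 'e) aug_state set \<Rightarrow> 'e out \<Rightarrow> ('x, 'e) aug_state set" where
  "obs_trans Q (Ev \<sigma>) = URw {q'. \<exists>q \<in> Q. q' \<in> delta G_hat q (Plain \<sigma>)}"
| "obs_trans Q (Lab i) =
     URw {q'. \<exists>q \<in> Q. \<exists>a \<in> Gamma_hat. q' \<in> delta G_hat q a \<and> Pm a = Lab i}"

definition Obs_hat :: "(('x, 'e) aug_state set, 'e out) det" where
  "Obs_hat = \<lparr>dstates = Pow X_hat,
              devents = Gw \<union> Ev ` (Eo - \<Gamma>),
              dtrans = obs_trans,
              dinits = {URw (inits G_hat)}\<rparr>"

definition m_of :: "('x, 'e) aug_state set \<Rightarrow> 'x set" where
  "m_of Q = {y \<in> states G. \<exists>p'. (y, p') \<in> Q}"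

definition n_of :: "('x, 'e) aug_state \<Rightarrow> ('x, 'e) aug_state set \<Rightarrow> ('x, 'e) aug_state set" where
  "n_of q Q = {(y, p') \<in> Q. y = fst q}"

text \<open>\<open>ASw q Q\<close> is used for \<open>q \<in> Q \<subseteq> X_hat\<close> only, so that \<open>m_of Q\<close> has at least one element.\<close>

definition ASw :: "('x, 'e) aug_state \<Rightarrow> ('x, 'e) aug_state set \<Rightarrow> ('x, 'e) aug_state set" where
  "ASw q Q = (if card (m_of Q) > 1 then URw (Q - n_of q Q) else {})"

definition Obs_w :: "(('x, 'e) aug_state set, 'e out) det" where
  "Obs_w = Obs_hat\<lparr>dinits :=
     {ASw q Q | q Q. q \<in> Q \<and> Q \<noteq> {} \<and> Q \<in> dreachable Obs_hat}\<rparr>"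


subsection \<open>Concurrent composition\<close>

text \<open>Events are pairs of an event of the augmented automaton and a string of length at most 1;
  the second component is empty exactly for unobservable events.\<close>

definition Cc :: "(('x, 'e) aug_state \<times> ('x, 'e) aug_state set, 'e aug \<times> 'e out list) nfa" where
  "Cc = \<lparr>states = X_hat \<times> Pow X_hat,
         events = {(a, Pn [a]) | a. a \<in> Gamma_hat \<union> Plain ` (Eo - \<Gamma>)}
                  \<union> {(a, []) | a. a \<in> Plain ` Euo},
         delta = (\<lambda>(q, Q) (a, w). {(q', Q').
           q' \<in> delta G_hat_w q a \<and>
           (a \<in> Gamma_hat \<union> Plain ` (Eo - \<Gamma>) \<and> w = Pn [a] \<and>
              (\<exists>c. Pn [a] = [c] \<and> Q' = dtrans Obs_w Q c)
            \<or> a \<in> Plain ` Euo \<and> w = [] \<and> Q' = Q)}),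
         inits = {(q, ASw q Q) | q Q. q \<in> Q \<and> Q \<noteq> {} \<and> Q \<in> dreachable Obs_hat}\<rparr>"

definition Rc :: "('e aug \<times> 'e out list) list \<Rightarrow> 'e out list" where
  "Rc s = concat (map snd s)"

definition Cc_reachable ::
    "(('x, 'e) aug_state \<times> ('x, 'e) aug_state set) set" where
  "Cc_reachable = {z. \<exists>z0 \<in> inits Cc. \<exists>s \<in> lists (events Cc). z \<in> delta_star Cc z0 s}"

definition Cc_reachable_within ::
    "nat \<Rightarrow> (('x, 'e) aug_state \<times> ('x, 'e) aug_state set) set" where
  "Cc_reachable_within K =
     {z. \<exists>z0 \<in> inits Cc. \<exists>s \<in> lists (events Cc). length (Rc s) \<le> K \<and> z \<in> delta_star Cc z0 s}"

end

end

theory Submission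
  imports Defs
begin

text \<open>A run of the augmented automaton is a run of \<open>G\<close> decorated with the order in which anonymous
  events first occurred, and \<open>Pn\<close> of the decorated string is \<open>Pw\<close> of the original one. Hence the
  observer state after \<open>\<alpha>\<close> is the set of pairs \<open>(x, p)\<close> in which a string with projection \<open>\<alpha>\<close>
  may end, and \<open>x\<close> lies in the delayed estimate of \<open>\<alpha>\<close> and \<open>\<beta>\<close> iff some \<open>(x, p)\<close> in that set
  has a run with output \<open>\<beta>\<close>. As observer states are closed under unobservable reach, the variant
  observer started in \<open>ASw (x, p) Q\<close> is in \<open>{}\<close> after \<open>\<beta>\<close> iff no \<open>(y, p')\<close> in \<open>Q\<close> with
  \<open>y \<noteq> x\<close> has such a run. So \<open>{}\<close> is reached exactly when some delayed estimate is a singleton.\<close>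

section \<open>Run concatenation, and histories as sets built from lists\<close>

lemma delta_star_append:
  "delta_star A q (u @ v) = (\<Union>q' \<in> delta_star A q u. delta_star A q' v)"
  by (induction u arbitrary: q) auto

lemma mem_history_iff:
  "Idx \<sigma> i \<in> history l \<longleftrightarrow> (\<exists>k < length l. i = Suc k \<and> \<sigma> = l ! k)"
  by (auto simp: history_def)

text \<open>The indices record the order, so the list can be read back from the set. This identifies
  the list chosen by a rule of \<open>aug_step\<close> with the list tracked along a run.\<close>

lemma inj_history: "inj history"
proof (rule injI)
  fix l l' :: "'e list"
  assume eq: "history l = history l'"
  have k: "k < length l \<longleftrightarrow> (\<exists>\<sigma>. Idx \<sigma> (Suc k) \<in> history l)" for k and l :: "'e list"
    by (auto simp: mem_history_iff)
  have "k < length l \<longleftrightarrow> k < length l'" for k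
    using k[of k l] k[of k l'] eq by simp
  then have len: "length l = length l'"
    by (meson linorder_neqE_nat less_irrefl)
  have "l ! k = l' ! k" if "k < length l" for k
  proof -
    have "Idx (l ! k) (Suc k) \<in> history l'"
      using that by (simp add: eq[symmetric] mem_history_iff)
    then show ?thesis by (simp add: mem_history_iff)
  qed
  with len show "l = l'" by (intro nth_equalityI)
qed

lemma history_snoc: "history (l @ [\<sigma>]) = history l \<union> {Idx \<sigma> (Suc (length l))}"
proof -
  have "history (l @ [\<sigma>]) = (\<lambda>k. Idx ((l @ [\<sigma>]) ! k) (Suc k)) ` {..<Suc (length l)}"
    by (auto simp: history_def)
  also have "\<dots> = (\<lambda>k. Idx (l ! k) (Suc k)) ` {..<length l} \<union> {Idx \<sigma> (Suc (length l))}"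
    by (simp add: lessThan_Suc nth_append)
  finally show ?thesis
    by (auto simp: history_def)
qed

lemma takeWhile_neq_nth:
  assumes "distinct l" "k < length l"
  shows "length (takeWhile (\<lambda>\<tau>. \<tau> \<noteq> l ! k) l) = k"
  using assms
proof (induction l arbitrary: k)
  case (Cons a l)
  then show ?case by (cases k) auto
qed simp

lemma takeWhile_neq_notin:
  assumes "a \<notin> set l"
  shows "takeWhile (\<lambda>b. b \<noteq> a) l = l"
  using assms by (metis (mono_tags) takeWhile_eq_all_conv)

section \<open>Decorating strings with indices, and agreement with the projection
  \<open>Pw\<close>\<close>

context weak_anonymity
begin

text \<open>Histories are kept as lists in order of first occurrence, so that the next free index is
  determined by the length.\<close>

definition record_event :: "'e list \<Rightarrow> 'e \<Rightarrow> 'e list" where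
  "record_event l \<sigma> = (if \<sigma> \<in> \<Gamma> \<and> \<sigma> \<notin> set l then l @ [\<sigma>] else l)"

text \<open>If \<open>\<sigma>\<close> does not occur in \<open>l\<close>, then \<open>takeWhile\<close> returns all of \<open>l\<close>, so that \<open>\<sigma>\<close> gets the
  first unused index.\<close>

definition mark :: "'e list \<Rightarrow> 'e \<Rightarrow> 'e aug" where
  "mark l \<sigma> =
     (if \<sigma> \<in> \<Gamma> then Idx \<sigma> (Suc (length (takeWhile (\<lambda>\<tau>. \<tau> \<noteq> \<sigma>) l))) else Plain \<sigma>)"

text \<open>The list argument is the history accumulated beforehand; it allows a suffix to be
  decorated on its own.\<close>

primrec marks :: "'e list \<Rightarrow> 'e list \<Rightarrow> 'e aug list" where
  "marks l [] = []"
| "marks l (\<sigma> # s) = mark l \<sigma> # marks (record_event l \<sigma>) s"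

abbreviation first_occs :: "'e list \<Rightarrow> 'e list" where
  "first_occs s \<equiv> foldl record_event [] s"

lemma marks_append: "marks l (s @ t) = marks l s @ marks (foldl record_event l s) t"
  by (induction s arbitrary: l) auto

lemma record_event_wf:
  "distinct l \<Longrightarrow> set l \<subseteq> \<Gamma> \<Longrightarrow> distinct (record_event l \<sigma>) \<and> set (record_event l \<sigma>) \<subseteq> \<Gamma>"
  by (simp add: record_event_def)

lemma first_occs_wf: "distinct (first_occs s) \<and> set (first_occs s) = set s \<inter> \<Gamma>"
  by (induction s rule: rev_induct) (auto simp: record_event_def)

text \<open>Until \<open>\<sigma>\<close> occurs, \<open>takeWhile\<close> cuts nothing on either
  side; afterwards both sides are frozen. This carries the prefix counted by \<open>rank\<close>
  over to the recorded list.\<close>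

lemma first_occs_takeWhile:
  assumes "\<sigma> \<in> \<Gamma>"
  shows "first_occs (takeWhile (\<lambda>\<tau>. \<tau> \<noteq> \<sigma>) s) = takeWhile (\<lambda>\<tau>. \<tau> \<noteq> \<sigma>) (first_occs s)"
proof (induction s rule: rev_induct)
  case (snoc \<tau> s)
  show ?case
  proof (cases "\<sigma> \<in> set s")
    case True
    moreover have "\<sigma> \<in> set (first_occs s)"
      using True assms first_occs_wf by blast
    \<comment> \<open>\<open>\<sigma>\<close> is already recorded, so an event appended at the end
      lies outside the part before it.\<close>
    then have "takeWhile (\<lambda>\<tau>. \<tau> \<noteq> \<sigma>) (record_event (first_occs s) \<tau>)
        = takeWhile (\<lambda>\<tau>. \<tau> \<noteq> \<sigma>) (first_occs s)"
      by (auto simp: record_event_def)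
    ultimately show ?thesis
      using snoc by simp
  next
    case False
    then have "\<sigma> \<notin> set (first_occs s)"
      using first_occs_wf[of s] by auto
    then have "takeWhile (\<lambda>\<tau>. \<tau> \<noteq> \<sigma>) (first_occs (s @ [\<tau>]))
        = (if \<tau> = \<sigma> then first_occs s else first_occs (s @ [\<tau>]))"
      using assms by (auto simp: record_event_def takeWhile_append2 takeWhile_tail takeWhile_neq_notin)
    moreover have "takeWhile (\<lambda>\<tau>. \<tau> \<noteq> \<sigma>) (s @ [\<tau>]) = (if \<tau> = \<sigma> then s else s @ [\<tau>])"
      using False by (auto simp: takeWhile_append2 takeWhile_tail takeWhile_neq_notin)
    ultimately show ?thesis
      by simp
  qed
qed simp

text \<open>The recorded list is distinct, so its length counts the anonymous events seen. The
  right-hand side is the index that \<open>mark\<close> assigns, both for a repeated and for a new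
  \<open>\<sigma>\<close>.\<close>

lemma rank_eq:
  assumes "\<sigma> \<in> \<Gamma>"
  shows "rank (s @ [\<sigma>]) \<sigma> = Suc (length (takeWhile (\<lambda>\<tau>. \<tau> \<noteq> \<sigma>) (first_occs s)))"
proof -
  have "length (first_occs u) = card (set u \<inter> \<Gamma>)" for u
    using first_occs_wf[of u] distinct_card by fastforce
  moreover have "takeWhile (\<lambda>\<tau>. \<tau> \<noteq> \<sigma>) (s @ [\<sigma>]) = takeWhile (\<lambda>\<tau>. \<tau> \<noteq> \<sigma>) s"
    by (induction s) auto
  ultimately show ?thesis
    by (simp add: rank_def first_occs_takeWhile[OF assms, symmetric])
qed

section \<open>Splitting words by output, and reachability under a given output\<close>

lemma Pn_Nil [simp]: "Pn [] = []"
  and Pn_Cons [simp]: "Pn (a # w) = Pn_letter a @ Pn w"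
  and Pn_append: "Pn (v @ w) = Pn v @ Pn w"
  by (simp_all add: Pn_def)

lemma Pw_eq_Pn_marks: "Pw s = Pn (marks [] s)"
  by (induction s rule: rev_induct)
    (auto simp: marks_append Pn_append rank_eq mark_def)

text \<open>The labels of \<open>t\<close> depend on the past \<open>s\<close> only through the
  order of first occurrences.\<close>

lemma Pw_append: "Pw (s @ t) = Pw s @ Pn (marks (first_occs s) t)"
  by (simp add: Pw_eq_Pn_marks marks_append Pn_append)

lemma length_Pn_letter: "length (Pn_letter a) \<le> 1"
  by (cases a) auto

text \<open>Each letter outputs at most one symbol, so no letter straddles a cut of the
  output.\<close>

lemma Pn_eq_appendE:
  assumes "Pn w = u @ v"
  obtains w1 w2 where "w = w1 @ w2" "Pn w1 = u" "Pn w2 = v"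
proof -
  have "\<exists>w1 w2. w = w1 @ w2 \<and> Pn w1 = u \<and> Pn w2 = v"
    using assms
  proof (induction w arbitrary: u)
    case (Cons a w)
    show ?case
    proof (cases u)
      case Nil
      with Cons.prems show ?thesis
        by (intro exI[of _ "[]"] exI[of _ "a # w"]) simp
    next
      case [simp]: (Cons c u')
      have "\<exists>u''. u = Pn_letter a @ u'' \<and> Pn w = u'' @ v"
        using Cons.prems length_Pn_letter[of a]
        by (cases "Pn_letter a") auto
      then obtain u'' where u: "u = Pn_letter a @ u''" "Pn w = u'' @ v"
        by blast
      from Cons.IH[OF u(2)] obtain w1 w2
        where "w = w1 @ w2" "Pn w1 = u''" "Pn w2 = v"
        by blast
      with u(1) show ?thesis
        by (intro exI[of _ "a # w1"] exI[of _ w2]) simp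
    qed
  qed simp
  with that show thesis by blast
qed

lemma Pn_eq_singletonE:
  assumes "Pn w = [c]"
  obtains w1 a w2 where "w = w1 @ a # w2" "Pn w1 = []" "Pn_letter a = [c]" "Pn w2 = []"
proof -
  have "\<exists>w1 a w2. w = w1 @ a # w2 \<and> Pn w1 = [] \<and> Pn_letter a = [c] \<and> Pn w2 = []"
    using assms
  proof (induction w)
    case (Cons b w)
    show ?case
    proof (cases "Pn_letter b")
      case Nil
      with Cons obtain w1 a w2
        where "w = w1 @ a # w2" "Pn w1 = []" "Pn_letter a = [c]" "Pn w2 = []"
        by auto
      with Nil show ?thesis
        by (intro exI[of _ "b # w1"] exI[of _ a] exI[of _ w2]) simp
    next
      case (Cons d ds)
      with Cons.prems show ?thesis
        by (intro exI[of _ "[]"] exI[of _ b] exI[of _ w]) simp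
    qed
  qed simp
  with that show thesis by blast
qed

text \<open>The common semantic form of unobservable reach (output \<open>[]\<close>), observer
  transitions and \<open>ASw\<close>. The word \<open>w\<close> ranges over all lists;
  \<open>delta_star_G_hat_wf\<close> later shows that only words over \<open>events G_hat\<close>
  have runs.\<close>

definition reach :: "('x, 'e) aug_state set \<Rightarrow> 'e out list \<Rightarrow> ('x, 'e) aug_state set" where
  "reach Q \<beta> = {q'. \<exists>q \<in> Q. \<exists>w. Pn w = \<beta> \<and> q' \<in> delta_star G_hat q w}"

text \<open>With \<open>\<beta> = []\<close> this also yields that every
  \<open>reach Q \<alpha>\<close> is closed under silent moves.\<close>

lemma reach_append: "reach Q (\<alpha> @ \<beta>) = reach (reach Q \<alpha>) \<beta>"
proof
  show "reach Q (\<alpha> @ \<beta>) \<subseteq> reach (reach Q \<alpha>) \<beta>"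
  proof
    fix q'
    assume "q' \<in> reach Q (\<alpha> @ \<beta>)"
    then obtain q w where "q \<in> Q" "Pn w = \<alpha> @ \<beta>" "q' \<in> delta_star G_hat q w"
      by (auto simp: reach_def)
    moreover from this(2) obtain w1 w2 where "w = w1 @ w2" "Pn w1 = \<alpha>" "Pn w2 = \<beta>"
      by (rule Pn_eq_appendE)
    ultimately show "q' \<in> reach (reach Q \<alpha>) \<beta>"
      by (auto simp: reach_def delta_star_append)
  qed
  show "reach (reach Q \<alpha>) \<beta> \<subseteq> reach Q (\<alpha> @ \<beta>)"
  proof
    fix q'
    assume "q' \<in> reach (reach Q \<alpha>) \<beta>"
    then obtain q r v w where "q \<in> Q" "Pn v = \<alpha>" "r \<in> delta_star G_hat q v"
      "Pn w = \<beta>" "q' \<in> delta_star G_hat r w"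
      by (auto simp: reach_def)
    then have "Pn (v @ w) = \<alpha> @ \<beta>" "q' \<in> delta_star G_hat q (v @ w)"
      by (auto simp: Pn_append delta_star_append)
    with \<open>q \<in> Q\<close> show "q' \<in> reach Q (\<alpha> @ \<beta>)"
      unfolding reach_def by blast
  qed
qed

lemma reach_empty_iff: "reach Q \<beta> = {} \<longleftrightarrow> (\<forall>q \<in> Q. reach {q} \<beta> = {})"
  by (auto simp: reach_def)

lemma reach_mono: "Q \<subseteq> Q' \<Longrightarrow> reach Q \<beta> \<subseteq> reach Q' \<beta>"
  by (auto simp: reach_def)

end

section \<open>Runs of the augmented automaton as decorated runs of \<open>G\<close>\<close>

locale finite_weak_anonymity = weak_anonymity G Eo Euo \<Gamma>
  for G :: "('x, 'e) nfa" and Eo Euo \<Gamma> :: "'e set" +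
  assumes finite_G: "finite_nfa G"
    and events_G: "events G = Eo \<union> Euo"
    and disjoint: "Eo \<inter> Euo = {}"
    and Gamma_subset: "\<Gamma> \<subseteq> Eo"
begin

lemma finite_states: "finite (states G)"
  and finite_Gamma: "finite \<Gamma>"
  and inits_states: "inits G \<subseteq> states G"
  using finite_G events_G Gamma_subset finite_subset
  by (auto simp: finite_nfa_def)

lemma delta_states:
  "x \<in> states G \<Longrightarrow> a \<in> Eo \<union> Euo \<Longrightarrow> x' \<in> delta G x a \<Longrightarrow> x' \<in> states G"
  using finite_G events_G unfolding finite_nfa_def by blast

lemma delta_star_states:
  "x \<in> states G \<Longrightarrow> s \<in> lists (Eo \<union> Euo) \<Longrightarrow> x' \<in> delta_star G x s \<Longrightarrow> x' \<in> states G"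
proof (induction s arbitrary: x)
  case (Cons a s)
  then show ?case using delta_states[of x a] by auto
qed simp

text \<open>The rules \<open>plain\<close>, \<open>seen\<close> and \<open>fresh\<close> are the
  cases \<open>\<sigma> \<notin> \<Gamma>\<close>, \<open>\<sigma>\<close> in \<open>l\<close>, and
  \<open>\<sigma>\<close> anonymous but not in \<open>l\<close>; \<open>mark\<close> and
  \<open>record_event\<close> treat them uniformly.\<close>

lemma aug_step_history_iff:
  assumes "distinct l" "set l \<subseteq> \<Gamma>"
  shows "aug_step (x, history l) a (x', p') \<longleftrightarrow>
    x \<in> states G \<and> (\<exists>\<sigma> \<in> Eo \<union> Euo. a = mark l \<sigma> \<and> p' = history (record_event l \<sigma>) \<and> x' \<in> delta G x \<sigma>)"
    (is "?L \<longleftrightarrow> ?R")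
proof
  assume ?L
  then show ?R
  proof cases
    case (plain e)
    then show ?thesis
      using Gamma_subset disjoint by (auto simp: mark_def record_event_def)
  next
    case (seen l' k)
    then have "l' = l" using inj_history by (auto dest: injD)
    then have "l ! k \<in> set l" using seen by simp
    then have "l ! k \<in> \<Gamma>" "l ! k \<in> Eo" using assms Gamma_subset by blast+
    with \<open>l ! k \<in> set l\<close> show ?thesis
      using seen \<open>l' = l\<close>
      by (intro conjI bexI[of _ "l ! k"]) (auto simp: mark_def record_event_def takeWhile_neq_nth)
  next
    case (fresh l' \<sigma>)
    then have "l' = l" using inj_history by (auto dest: injD)
    then show ?thesis
      using fresh Gamma_subset
      by (intro conjI bexI[of _ \<sigma>])
        (auto simp: mark_def record_event_def history_snoc takeWhile_neq_notin)
  qed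
next
  assume ?R
  then obtain \<sigma> where x: "x \<in> states G" and \<sigma>: "\<sigma> \<in> Eo \<union> Euo" "a = mark l \<sigma>"
    "p' = history (record_event l \<sigma>)" "x' \<in> delta G x \<sigma>"
    by blast
  have hist: "history l \<in> histories" using assms by (auto simp: histories_def)
  consider "\<sigma> \<notin> \<Gamma>" | "\<sigma> \<in> set l" | "\<sigma> \<in> \<Gamma>" "\<sigma> \<notin> set l" by blast
  then show ?L
  proof cases
    case 1
    then show ?thesis
      using \<sigma> x hist by (auto simp: mark_def record_event_def intro: aug_step.plain)
  next
    case 2
    then obtain k where k: "k < length l" "\<sigma> = l ! k" by (auto simp: in_set_conv_nth)
    moreover have "mark l \<sigma> = Idx (l ! k) (Suc k)"
      using k 2 assms by (auto simp: mark_def takeWhile_neq_nth)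
    ultimately show ?thesis
      using \<sigma> x assms 2 by (auto simp: record_event_def intro: aug_step.seen)
  next
    case 3
    then show ?thesis
      using \<sigma> x assms 3 aug_step.fresh[of x l \<sigma> x']
      by (auto simp: mark_def record_event_def history_snoc takeWhile_neq_notin)
  qed
qed

text \<open>Iterates the one-step description. Both \<open>x\<close> and \<open>l\<close> stay
  general in the induction, since a step may change either.\<close>

lemma delta_star_G_hat_iff:
  assumes "x \<in> states G" "distinct l" "set l \<subseteq> \<Gamma>"
  shows "(x', p') \<in> delta_star G_hat (x, history l) w \<longleftrightarrow>
    (\<exists>s \<in> lists (Eo \<union> Euo). w = marks l s \<and> p' = history (foldl record_event l s) \<and> x' \<in> delta_star G x s)"
  using assms
proof (induction w arbitrary: x l)
  case Nil
  have "[] = marks l s \<longleftrightarrow> s = []" for s by (cases s) auto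
  then show ?case by auto
next
  case (Cons a w)
  note IH = Cons.IH and prems = Cons.prems
  show ?case (is "?L \<longleftrightarrow> ?R")
  proof
    assume ?L
    then obtain y p where y: "aug_step (x, history l) a (y, p)"
      "(x', p') \<in> delta_star G_hat (y, p) w"
      by (auto simp: G_hat_def)
    then obtain \<sigma> where \<sigma>: "\<sigma> \<in> Eo \<union> Euo" "a = mark l \<sigma>"
      "p = history (record_event l \<sigma>)" "y \<in> delta G x \<sigma>"
      using aug_step_history_iff prems by auto
    have "y \<in> states G" using \<sigma> prems delta_states by blast
    then obtain s where "s \<in> lists (Eo \<union> Euo)" "w = marks (record_event l \<sigma>) s"
      "p' = history (foldl record_event (record_event l \<sigma>) s)" "x' \<in> delta_star G y s"
      using IH[of y "record_event l \<sigma>"] y(2) \<sigma>(3) record_event_wf[OF prems(2,3)] by auto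
    with \<sigma> show ?R by (intro bexI[of _ "\<sigma> # s"]) auto
  next
    assume ?R
    then obtain s where s: "s \<in> lists (Eo \<union> Euo)" "a # w = marks l s"
      "p' = history (foldl record_event l s)" "x' \<in> delta_star G x s"
      by blast
    then obtain \<sigma> t where [simp]: "s = \<sigma> # t" by (cases s) auto
    from s obtain y where y: "y \<in> delta G x \<sigma>" "x' \<in> delta_star G y t" by auto
    have \<sigma>: "\<sigma> \<in> Eo \<union> Euo" using s by simp
    have "aug_step (x, history l) a (y, history (record_event l \<sigma>))"
      using aug_step_history_iff prems \<sigma> s y by auto
    moreover have "y \<in> states G" using y \<sigma> prems delta_states by blast
    then have "(x', p') \<in> delta_star G_hat (y, history (record_event l \<sigma>)) w"
      using IH[of y "record_event l \<sigma>"] s y record_event_wf[OF prems(2,3)] by auto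
    ultimately show ?L by (auto simp: G_hat_def)
  qed
qed

lemma aug_step_wf:
  assumes "aug_step q a q'"
  shows "q \<in> X_hat" "q' \<in> X_hat" "a \<in> events G_hat"
proof -
  obtain x l where q: "q = (x, history l)" and l: "distinct l" "set l \<subseteq> \<Gamma>"
    using assms by (cases rule: aug_step.cases) (auto simp: histories_def)
  obtain x' p' where q': "q' = (x', p')" by (cases q')
  obtain \<sigma> where \<sigma>: "x \<in> states G" "\<sigma> \<in> Eo \<union> Euo" "a = mark l \<sigma>"
    "p' = history (record_event l \<sigma>)" "x' \<in> delta G x \<sigma>"
    using assms aug_step_history_iff[OF l] unfolding q q' by blast
  show "q \<in> X_hat" using \<sigma> l q by (auto simp: X_hat_def histories_def)
  show "q' \<in> X_hat"
    using \<sigma> delta_states record_event_wf[OF l, of \<sigma>] q'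
    unfolding X_hat_def histories_def by blast
  \<comment> \<open>The index bound of \<open>Gamma_hat\<close> is not part of the rules: it holds
    because \<open>\<sigma>\<close> and the events recorded before it are distinct members of
    \<open>\<Gamma>\<close>.\<close>
  have "Suc (length (takeWhile (\<lambda>\<tau>. \<tau> \<noteq> \<sigma>) l)) \<le> card \<Gamma>" if "\<sigma> \<in> \<Gamma>"
  proof -
    let ?u = "takeWhile (\<lambda>\<tau>. \<tau> \<noteq> \<sigma>) l"
    have "distinct (\<sigma> # ?u)" using l by (auto dest: set_takeWhileD)
    then have "Suc (length ?u) = card (set (\<sigma> # ?u))"
      by (metis distinct_card length_Cons)
    also have "\<dots> \<le> card \<Gamma>"
      using l that by (intro card_mono finite_Gamma) (auto dest: set_takeWhileD)
    finally show ?thesis .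
  qed
  then show "a \<in> events G_hat"
    using \<sigma> by (auto simp: G_hat_def Gamma_hat_def mark_def)
qed

lemma delta_star_G_hat_wf:
  assumes "q' \<in> delta_star G_hat q w"
  shows "w \<in> lists (events G_hat)" and "q \<in> X_hat \<Longrightarrow> q' \<in> X_hat"
proof -
  have "w \<in> lists (events G_hat) \<and> (q \<in> X_hat \<longrightarrow> q' \<in> X_hat)"
    using assms
  proof (induction w arbitrary: q)
    case (Cons a w)
    then obtain r where "aug_step q a r" "q' \<in> delta_star G_hat r w"
      by (auto simp: G_hat_def)
    with Cons.IH[of r] aug_step_wf show ?case by auto
  qed simp
  then show "w \<in> lists (events G_hat)" and "q \<in> X_hat \<Longrightarrow> q' \<in> X_hat" by auto
qed

section \<open>Observer states and adjoint state sets as instances of \<open>reach\<close>\<close>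

lemma reach_X_hat: "Q \<subseteq> X_hat \<Longrightarrow> reach Q \<beta> \<subseteq> X_hat"
  using delta_star_G_hat_wf(2) by (fastforce simp: reach_def)

text \<open>Turns the membership tests of the observers into conditions on outputs. The restriction
  to \<open>events G_hat\<close> matters: a \<open>Plain\<close> letter outside the alphabet also
  has empty output.\<close>

lemma Pn_letter_events:
  assumes "a \<in> events G_hat"
  shows "Pn_letter a = [] \<longleftrightarrow> a \<in> Plain ` Euo"
    and "Pn_letter a = [Ev \<sigma>] \<longleftrightarrow> a = Plain \<sigma> \<and> \<sigma> \<in> Eo - \<Gamma>"
    and "Pn_letter a = [Lab i] \<longleftrightarrow> a \<in> Gamma_hat \<and> Pm a = Lab i"
  using assms disjoint by (cases a; auto simp: G_hat_def Gamma_hat_def)+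

lemma Pn_in_lists_devents:
  assumes "w \<in> lists (events G_hat)"
  shows "Pn w \<in> lists (devents Obs_hat)"
  using assms
  by (induction w) (auto simp: G_hat_def Gamma_hat_def Obs_hat_def Gw_def)

lemma Pn_eq_Nil_iff:
  assumes "w \<in> lists (events G_hat)"
  shows "Pn w = [] \<longleftrightarrow> w \<in> lists (Plain ` Euo)"
  using assms by (induction w) (auto simp: Pn_letter_events(1))

text \<open>\<open>URw\<close> intersects with \<open>X_hat\<close> while \<open>reach Q []\<close>
  contains all of \<open>Q\<close>, whence the assumption.\<close>

lemma URw_eq_reach:
  assumes "Q \<subseteq> X_hat"
  shows "URw Q = reach Q []"
proof
  have "Plain ` Euo \<subseteq> events G_hat" by (auto simp: G_hat_def)
  then show "URw Q \<subseteq> reach Q []"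
    unfolding URw_def reach_def using Pn_eq_Nil_iff lists_mono by fastforce
  show "reach Q [] \<subseteq> URw Q"
    using assms delta_star_G_hat_wf Pn_eq_Nil_iff unfolding URw_def reach_def by blast
qed

lemma delta_G_hat: "q' \<in> delta G_hat q a \<longleftrightarrow> aug_step q a q'"
  by (simp add: G_hat_def)

text \<open>\<open>obs_trans\<close> takes silent moves only after the visible one; those before it
  are absorbed because \<open>Q\<close> is closed under them.\<close>

lemma obs_trans_eq_reach:
  assumes Q: "Q \<subseteq> X_hat" "reach Q [] = Q" and c: "c \<in> devents Obs_hat"
  shows "obs_trans Q c = reach Q [c]"
proof -
  \<comment> \<open>The states after exactly one visible step, before the silent closure.\<close>
  let ?N = "{q'. \<exists>q \<in> Q. \<exists>a. Pn_letter a = [c] \<and> aug_step q a q'}"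
  have "?N \<subseteq> X_hat" using aug_step_wf by blast
  moreover have "obs_trans Q c = URw ?N"
  proof (cases c)
    case (Lab i)
    then have "(\<exists>a \<in> Gamma_hat. q' \<in> delta G_hat q a \<and> Pm a = Lab i)
        \<longleftrightarrow> (\<exists>a. Pn_letter a = [c] \<and> aug_step q a q')" for q q'
      using Pn_letter_events(3) aug_step_wf(3) by (metis delta_G_hat)
    then show ?thesis using Lab by simp
  next
    case (Ev \<sigma>)
    with c have "\<sigma> \<in> Eo - \<Gamma>" by (auto simp: Obs_hat_def Gw_def)
    then have "q' \<in> delta G_hat q (Plain \<sigma>)
        \<longleftrightarrow> (\<exists>a. Pn_letter a = [c] \<and> aug_step q a q')" for q q'
      using Pn_letter_events(2) aug_step_wf(3) Ev by (metis delta_G_hat)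
    then show ?thesis using Ev by simp
  qed
  ultimately have "obs_trans Q c = reach ?N []" by (simp add: URw_eq_reach)
  also have "\<dots> = reach Q [c]"
  proof
    have "?N \<subseteq> reach Q [c]"
    proof
      fix q'
      assume "q' \<in> ?N"
      then obtain q a where "q \<in> Q" "Pn_letter a = [c]" "aug_step q a q'" by blast
      then show "q' \<in> reach Q [c]"
        by (auto simp: reach_def G_hat_def intro!: bexI[of _ q] exI[of _ "[a]"])
    qed
    then show "reach ?N [] \<subseteq> reach Q [c]"
      using reach_mono[of ?N "reach Q [c]" "[]"] reach_append[of Q "[c]" "[]"] by simp
    show "reach Q [c] \<subseteq> reach ?N []"
    proof
      fix q'
      assume "q' \<in> reach Q [c]"
      then obtain q w where q: "q \<in> Q" "Pn w = [c]" "q' \<in> delta_star G_hat q w"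
        by (auto simp: reach_def)
      from q(2) obtain w1 a w2
        where w: "w = w1 @ a # w2" "Pn w1 = []" "Pn_letter a = [c]" "Pn w2 = []"
        by (rule Pn_eq_singletonE)
      then obtain r r' where r: "r \<in> delta_star G_hat q w1" "aug_step r a r'"
        "q' \<in> delta_star G_hat r' w2"
        using q by (auto simp: delta_star_append G_hat_def)
      \<comment> \<open>The silent prefix \<open>w1\<close> cannot leave the closed set
        \<open>Q\<close>.\<close>
      have "r \<in> Q" using r q w Q(2) by (auto simp: reach_def)
      then have "r' \<in> ?N" using r w by blast
      then show "q' \<in> reach ?N []" using r w unfolding reach_def by blast
    qed
  qed
  finally show ?thesis .
qed

lemma foldl_obs_trans:
  assumes "Q \<subseteq> X_hat" "\<alpha> \<in> lists (devents Obs_hat)"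
  shows "foldl obs_trans (reach Q []) \<alpha> = reach Q \<alpha>"
  using assms(2)
proof (induction \<alpha> rule: rev_induct)
  case (snoc c \<alpha>)
  have "reach (reach Q \<alpha>) [] = reach Q \<alpha>"
    using reach_append[of Q \<alpha> "[]"] by simp
  then show ?case
    using snoc obs_trans_eq_reach[of "reach Q \<alpha>" c] assms(1)
    by (simp add: reach_X_hat reach_append)
qed simp

lemma inits_G_hat_X_hat: "inits G_hat \<subseteq> X_hat"
proof -
  have "{} = history ([] :: 'e list)" by (simp add: history_def)
  then have "{} \<in> histories" unfolding histories_def by force
  then show ?thesis using inits_states by (auto simp: G_hat_def X_hat_def)
qed

text \<open>Since observer transitions are total, \<open>\<alpha>\<close> may be an output that no
  string produces; its observer state is then \<open>{}\<close>, which \<open>inits Cc\<close>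
  excludes.\<close>

lemma dreachable_Obs_hat:
  "dreachable Obs_hat = {reach (inits G_hat) \<alpha> | \<alpha>. \<alpha> \<in> lists (devents Obs_hat)}"
proof -
  have "dreachable Obs_hat =
      {foldl obs_trans (reach (inits G_hat) []) \<alpha> | \<alpha>. \<alpha> \<in> lists (devents Obs_hat)}"
    by (auto simp: dreachable_def Obs_hat_def URw_eq_reach[OF inits_G_hat_X_hat])
  also have "\<dots> = {reach (inits G_hat) \<alpha> | \<alpha>. \<alpha> \<in> lists (devents Obs_hat)}"
    by (rule Collect_cong) (metis foldl_obs_trans[OF inits_G_hat_X_hat])
  finally show ?thesis .
qed

text \<open>The two branches of \<open>ASw\<close> agree: if only one state of \<open>G\<close>
  occurs in \<open>Q\<close>, removing its pairs leaves nothing to reach from.\<close>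

lemma ASw_eq_reach:
  assumes "Q \<subseteq> X_hat" "q \<in> Q"
  shows "ASw q Q = reach (Q - n_of q Q) []"
proof (cases "card (m_of Q) > 1")
  case True
  then show ?thesis
    using assms URw_eq_reach[of "Q - n_of q Q"] by (auto simp: ASw_def)
next
  case False
  \<comment> \<open>Rules out that the cardinality is small only because an infinite set has
    \<open>card\<close> equal to 0.\<close>
  have "finite (m_of Q)" using finite_states by (auto simp: m_of_def)
  moreover have m: "fst r \<in> m_of Q" if "r \<in> Q" for r
    using that assms(1) by (cases r) (auto simp: m_of_def X_hat_def)
  ultimately have "fst r = fst q" if "r \<in> Q" for r
    using False m[OF that] m[OF assms(2)] card_le_Suc0_iff_eq[of "m_of Q"] by auto
  then have "Q - n_of q Q = {}" by (auto simp: n_of_def)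
  then have "reach (Q - n_of q Q) [] = {}" unfolding reach_def by blast
  with False show ?thesis by (simp add: ASw_def)
qed

section \<open>Runs of the concurrent composition\<close>

text \<open>Folding over \<open>Pn_letter a\<close> covers both kinds of letters: the empty output
  leaves \<open>S\<close> unchanged, a single symbol triggers one observer transition.\<close>

lemma delta_Cc:
  "(q', S') \<in> delta Cc (q, S) (a, u) \<and> (a, u) \<in> events Cc \<longleftrightarrow>
    aug_step q a q' \<and> u = Pn_letter a \<and> S' = foldl obs_trans S (Pn_letter a)"
    (is "?L \<longleftrightarrow> ?R")
proof
  assume ?L
  then have step: "aug_step q a q'" by (auto simp: Cc_def G_hat_w_def G_hat_def)
  have "a \<in> Plain ` Euo \<Longrightarrow> Pn_letter a = []"
    using Pn_letter_events(1) aug_step_wf(3) step by blast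
  with \<open>?L\<close> step show ?R by (auto simp: Cc_def Obs_w_def Obs_hat_def)
next
  assume R: ?R
  then have a: "a \<in> events G_hat" using aug_step_wf by blast
  show ?L
  proof (cases "Pn_letter a")
    case Nil
    with R a show ?thesis
      using Pn_letter_events(1) by (auto simp: Cc_def G_hat_w_def G_hat_def)
  next
    case (Cons c cs)
    then have "Pn_letter a = [c]" using length_Pn_letter[of a] by simp
    moreover from this have "a \<in> Gamma_hat \<union> Plain ` (Eo - \<Gamma>)"
      using a by (cases a) (auto simp: G_hat_def split: if_splits)
    ultimately show ?thesis
      using R by (auto simp: Cc_def G_hat_w_def G_hat_def Obs_w_def Obs_hat_def)
  qed
qed

text \<open>The observer component is total and deterministic, so it never blocks a run of
  \<open>G_hat\<close>, and its final state depends only on the output.\<close>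

lemma delta_star_Cc_iff:
  "(\<exists>s \<in> lists (events Cc). Rc s = \<beta> \<and> (q', S') \<in> delta_star Cc (q, S) s) \<longleftrightarrow>
    (\<exists>w. Pn w = \<beta> \<and> q' \<in> delta_star G_hat q w \<and> S' = foldl obs_trans S \<beta>)"
    (is "?L \<longleftrightarrow> ?R")
proof
  have "q' \<in> delta_star G_hat q (map fst s) \<and> Rc s = Pn (map fst s)
      \<and> S' = foldl obs_trans S (Pn (map fst s))"
    if "s \<in> lists (events Cc)" "(q', S') \<in> delta_star Cc (q, S) s" for s
    using that
  proof (induction s arbitrary: q S)
    case (Cons au s)
    obtain a u where [simp]: "au = (a, u)" by (cases au)
    from Cons.prems obtain r T
      where r: "(r, T) \<in> delta Cc (q, S) (a, u)" "(q', S') \<in> delta_star Cc (r, T) s"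
      by auto
    have "(a, u) \<in> events Cc" using Cons.hyps by simp
    with r(1) have "aug_step q a r" "u = Pn_letter a" "T = foldl obs_trans S (Pn_letter a)"
      using delta_Cc[of r T q S a u] by blast+
    moreover note Cons.IH[OF r(2)]
    moreover from calculation have "q' \<in> delta_star G_hat q (a # map fst s)"
      unfolding delta_star.simps using delta_G_hat by blast
    ultimately show ?case
      by (simp add: Rc_def)
  qed (simp add: Rc_def)
  then show "?L \<Longrightarrow> ?R" by metis
next
  \<comment> \<open>The second component of a letter of \<open>Cc\<close> is forced by the
    first.\<close>
  let ?s = "map (\<lambda>a. (a, Pn_letter a))"
  have "?s w \<in> lists (events Cc) \<and> Rc (?s w) = Pn w
      \<and> (q', foldl obs_trans S (Pn w)) \<in> delta_star Cc (q, S) (?s w)"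
    if "q' \<in> delta_star G_hat q w" for w
    using that
  proof (induction w arbitrary: q S)
    case (Cons a w)
    then obtain r where r: "aug_step q a r" "q' \<in> delta_star G_hat r w"
      by (auto simp: G_hat_def)
    define T where "T = foldl obs_trans S (Pn_letter a)"
    have step: "(r, T) \<in> delta Cc (q, S) (a, Pn_letter a)" "(a, Pn_letter a) \<in> events Cc"
      using delta_Cc[of r T q S a "Pn_letter a"] r(1) T_def by blast+
    note IH = Cons.IH[OF r(2), of T]
    then have "(q', foldl obs_trans T (Pn w)) \<in> delta_star Cc (q, S) (?s (a # w))"
      using step(1) unfolding list.map delta_star.simps by blast
    with step(2) IH show ?case by (simp add: Rc_def T_def)
  qed (simp add: Rc_def)
  then show "?R \<Longrightarrow> ?L" by blast
qed

section \<open>Delayed estimates in terms of \<open>reach\<close>\<close>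

lemma mem_reach_inits_iff:
  "(x, p) \<in> reach (inits G_hat) \<alpha> \<longleftrightarrow>
    (\<exists>x0 \<in> inits G. \<exists>s \<in> lists (Eo \<union> Euo).
       Pw s = \<alpha> \<and> p = history (first_occs s) \<and> x \<in> delta_star G x0 s)"
proof -
  have "(x, p) \<in> delta_star G_hat (x0, {}) w \<longleftrightarrow>
      (\<exists>s \<in> lists (Eo \<union> Euo). w = marks [] s \<and> p = history (first_occs s) \<and> x \<in> delta_star G x0 s)"
    if "x0 \<in> inits G" for x0 w
    using delta_star_G_hat_iff[of x0 "[]" x p w] that inits_states by (auto simp: history_def)
  then show ?thesis by (auto simp: reach_def G_hat_def Pw_eq_Pn_marks)
qed

text \<open>By \<open>Pw_append\<close>, the history stored in the state is all that the labels of a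
  continuation need to know about \<open>s\<close>.\<close>

lemma reach_first_occs_nonempty_iff:
  assumes "x \<in> states G"
  shows "reach {(x, history (first_occs s))} \<beta> \<noteq> {} \<longleftrightarrow>
    (\<exists>t \<in> lang_from G x. Pw (s @ t) = Pw s @ \<beta>)"
proof -
  have "(\<exists>q'. q' \<in> delta_star G_hat (x, history (first_occs s)) w) \<longleftrightarrow>
      (\<exists>t \<in> lang_from G x. w = marks (first_occs s) t)" for w
    using delta_star_G_hat_iff[OF assms, of "first_occs s" _ _ w] first_occs_wf[of s]
    unfolding lang_from_def events_G by (simp add: split_paired_Ex) blast
  then show ?thesis
    by (simp add: reach_def Pw_append) metis
qed

text \<open>The same \<open>p\<close> must serve past and future, because it fixes the labels of the
  continuation.\<close>

lemma mem_delayed_estimate_iff: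
  "x \<in> delayed_estimate \<alpha> \<beta> \<longleftrightarrow>
    (\<exists>p. (x, p) \<in> reach (inits G_hat) \<alpha> \<and> reach {(x, p)} \<beta> \<noteq> {})" (is "?L \<longleftrightarrow> ?R")
proof
  assume ?L
  then obtain x0 s t where s: "x \<in> states G" "x0 \<in> inits G" "s \<in> lists (Eo \<union> Euo)"
    "t \<in> lang_from G x" "Pw s = \<alpha>" "x \<in> delta_star G x0 s" "Pw (s @ t) = \<alpha> @ \<beta>"
    by (auto simp: delayed_estimate_def lang_from_def events_G)
  then have "reach {(x, history (first_occs s))} \<beta> \<noteq> {}"
    using reach_first_occs_nonempty_iff by blast
  moreover have "(x, history (first_occs s)) \<in> reach (inits G_hat) \<alpha>"
    using s mem_reach_inits_iff by blast
  ultimately show ?R by blast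
next
  assume ?R
  then obtain x0 s where s: "x0 \<in> inits G" "s \<in> lists (Eo \<union> Euo)" "Pw s = \<alpha>"
    "x \<in> delta_star G x0 s" "reach {(x, history (first_occs s))} \<beta> \<noteq> {}"
    by (auto simp: mem_reach_inits_iff)
  then have x: "x \<in> states G" using delta_star_states inits_states by blast
  with s obtain t where "t \<in> lang_from G x" "Pw (s @ t) = \<alpha> @ \<beta>"
    using reach_first_occs_nonempty_iff by blast
  moreover have "s \<in> lang_from G x0" using s by (auto simp: lang_from_def events_G)
  ultimately show ?L using s x unfolding delayed_estimate_def by blast
qed

text \<open>The right-hand side is the premise of anonymity, so only nonempty estimates are ever
  tested.\<close>

lemma delayed_estimate_nonempty_iff:
  "delayed_estimate \<alpha> \<beta> \<noteq> {} \<longleftrightarrow> (\<exists>s t. s @ t \<in> lang G \<and> Pw s = \<alpha> \<and> Pw (s @ t) = \<alpha> @ \<beta>)"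
    (is "?L \<longleftrightarrow> ?R")
proof
  assume ?L
  then obtain x x0 s t where s: "x0 \<in> inits G" "s \<in> lang_from G x0" "t \<in> lang_from G x"
    "Pw s = \<alpha>" "x \<in> delta_star G x0 s" "Pw (s @ t) = \<alpha> @ \<beta>"
    by (auto simp: delayed_estimate_def)
  then have "s @ t \<in> lang G"
    by (auto simp: lang_def lang_from_def delta_star_append)
  with s show ?R by blast
next
  assume ?R
  then obtain x0 s t where s: "x0 \<in> inits G" "s @ t \<in> lists (Eo \<union> Euo)"
    "delta_star G x0 (s @ t) \<noteq> {}" "Pw s = \<alpha>" "Pw (s @ t) = \<alpha> @ \<beta>"
    by (auto simp: lang_def lang_from_def events_G)
  then obtain x where x: "x \<in> delta_star G x0 s" "delta_star G x t \<noteq> {}"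
    by (auto simp: delta_star_append)
  have "x \<in> states G" using s x delta_star_states[of x0 s x] inits_states by auto
  moreover have "s \<in> lang_from G x0" "t \<in> lang_from G x"
    using s x by (auto simp: lang_from_def events_G)
  ultimately have "x \<in> delayed_estimate \<alpha> \<beta>"
    using s x unfolding delayed_estimate_def by blast
  then show ?L by blast
qed

section \<open>Empty observer components and singleton estimates\<close>

text \<open>\<open>n_of\<close> removes \<open>x\<close> with all its histories, and
  \<open>reach\<close> is empty iff it is empty from each remaining pair.\<close>

lemma empty_after_ASw_iff:
  assumes "\<alpha> \<in> lists (devents Obs_hat)" "\<beta> \<in> lists (devents Obs_hat)"
    and q: "(x, p) \<in> reach (inits G_hat) \<alpha>"
  shows "foldl obs_trans (ASw (x, p) (reach (inits G_hat) \<alpha>)) \<beta> = {} \<longleftrightarrow>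
    delayed_estimate \<alpha> \<beta> \<subseteq> {x}"
proof -
  let ?Q = "reach (inits G_hat) \<alpha>"
  have Q: "?Q \<subseteq> X_hat" using reach_X_hat inits_G_hat_X_hat by blast
  then have "foldl obs_trans (ASw (x, p) ?Q) \<beta> = reach (?Q - n_of (x, p) ?Q) \<beta>"
    using foldl_obs_trans[of "?Q - n_of (x, p) ?Q" \<beta>] assms by (auto simp: ASw_eq_reach)
  also have "\<dots> = {} \<longleftrightarrow> (\<forall>(y, p') \<in> ?Q. y \<noteq> x \<longrightarrow> reach {(y, p')} \<beta> = {})"
    by (subst reach_empty_iff) (auto simp: n_of_def)
  finally show ?thesis by (auto simp: mem_delayed_estimate_iff subset_iff)
qed

text \<open>The run of the first component puts \<open>x\<close> into the estimate; the empty second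
  component excludes every other state. The predicate \<open>P\<close> stands for the bound on the
  output length, or its absence.\<close>

lemma empty_reachable_iff:
  "(\<exists>q. \<exists>z0 \<in> inits Cc. \<exists>s \<in> lists (events Cc). P (Rc s) \<and> (q, {}) \<in> delta_star Cc z0 s) \<longleftrightarrow>
    (\<exists>\<alpha> \<beta> x. P \<beta> \<and> delayed_estimate \<alpha> \<beta> = {x})" (is "?L \<longleftrightarrow> ?R")
proof
  assume ?L
  then obtain q z0 s where s: "z0 \<in> inits Cc" "s \<in> lists (events Cc)" "P (Rc s)"
    "(q, {}) \<in> delta_star Cc z0 s" by blast
  then obtain x p \<alpha> where \<alpha>: "\<alpha> \<in> lists (devents Obs_hat)" "(x, p) \<in> reach (inits G_hat) \<alpha>"
    "z0 = ((x, p), ASw (x, p) (reach (inits G_hat) \<alpha>))"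
    by (auto simp: Cc_def dreachable_Obs_hat)
  obtain w where w: "Pn w = Rc s" "q \<in> delta_star G_hat (x, p) w"
    "{} = foldl obs_trans (ASw (x, p) (reach (inits G_hat) \<alpha>)) (Rc s)"
    using s \<alpha> delta_star_Cc_iff[of "Rc s" q "{}" "(x, p)"] by blast
  have "Rc s \<in> lists (devents Obs_hat)"
    using w Pn_in_lists_devents delta_star_G_hat_wf(1) by metis
  then have "delayed_estimate \<alpha> (Rc s) \<subseteq> {x}"
    using empty_after_ASw_iff[OF \<alpha>(1) _ \<alpha>(2)] w(3)[symmetric] by blast
  moreover have "reach {(x, p)} (Rc s) \<noteq> {}"
    using w unfolding reach_def by blast
  then have "x \<in> delayed_estimate \<alpha> (Rc s)"
    using \<alpha> mem_delayed_estimate_iff by blast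
  ultimately show ?R using s by blast
next
  assume ?R
  then obtain \<alpha> \<beta> x where e: "P \<beta>" "delayed_estimate \<alpha> \<beta> = {x}" by blast
  then obtain p where p: "(x, p) \<in> reach (inits G_hat) \<alpha>" "reach {(x, p)} \<beta> \<noteq> {}"
    using mem_delayed_estimate_iff by blast
  then obtain w q where w: "Pn w = \<beta>" "q \<in> delta_star G_hat (x, p) w"
    by (auto simp: reach_def)
  \<comment> \<open>This run serves to show that \<open>\<alpha>\<close> is a word over the
    observer's alphabet.\<close>
  obtain q0 v where v: "Pn v = \<alpha>" "(x, p) \<in> delta_star G_hat q0 v"
    using p by (auto simp: reach_def)
  have \<alpha>: "\<alpha> \<in> lists (devents Obs_hat)" and \<beta>: "\<beta> \<in> lists (devents Obs_hat)"
    using v w Pn_in_lists_devents delta_star_G_hat_wf(1) by blast+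
  let ?Q = "reach (inits G_hat) \<alpha>"
  have "foldl obs_trans (ASw (x, p) ?Q) \<beta> = {}"
    using empty_after_ASw_iff[OF \<alpha> \<beta> p(1)] e by simp
  then obtain s where "s \<in> lists (events Cc)" "Rc s = \<beta>"
    "(q, {}) \<in> delta_star Cc ((x, p), ASw (x, p) ?Q) s"
    using delta_star_Cc_iff[of \<beta> q "{}" "(x, p)" "ASw (x, p) ?Q"] w by auto
  moreover have "((x, p), ASw (x, p) ?Q) \<in> inits Cc"
    using p \<alpha> by (auto simp: Cc_def dreachable_Obs_hat)
  ultimately show ?L using e by blast
qed

text \<open>The premise makes the estimate nonempty and \<open>states G\<close> is finite, so the
  cardinality condition can fail only at a singleton.\<close>

lemma anonymous_iff:
  "(\<forall>s t \<alpha> \<beta>. s @ t \<in> lang G \<and> Pw s = \<alpha> \<and> Pw (s @ t) = \<alpha> @ \<beta> \<and> P \<beta>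
       \<longrightarrow> card (delayed_estimate \<alpha> \<beta>) > 1) \<longleftrightarrow>
    \<not> (\<exists>\<alpha> \<beta> x. P \<beta> \<and> delayed_estimate \<alpha> \<beta> = {x})"
proof -
  have "finite (delayed_estimate \<alpha> \<beta>)" for \<alpha> \<beta>
    using finite_states by (auto simp: delayed_estimate_def)
  then have "card (delayed_estimate \<alpha> \<beta>) > 1 \<longleftrightarrow>
      delayed_estimate \<alpha> \<beta> \<noteq> {} \<and> (\<nexists>x. delayed_estimate \<alpha> \<beta> = {x})" for \<alpha> \<beta>
    by (metis One_nat_def card_0_eq card_1_singletonE is_singletonI is_singleton_altdef less_one
        linorder_neqE_nat not_less_iff_gr_or_eq)
  moreover have "(\<exists>x. delayed_estimate \<alpha> \<beta> = {x}) \<Longrightarrow> delayed_estimate \<alpha> \<beta> \<noteq> {}" for \<alpha> \<beta>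
    by auto
  ultimately show ?thesis
    using delayed_estimate_nonempty_iff by metis
qed

end

theorem theorem2:
  fixes G :: "('x, 'e) nfa" and Eo Euo \<Gamma> :: "'e set"
  assumes "finite_nfa G"
    and "events G = Eo \<union> Euo" and "Eo \<inter> Euo = {}"
    and "\<Gamma> \<subseteq> Eo" and "card \<Gamma> \<ge> 2"
  shows "(weak_anonymity.infinite_step_weakly_anonymous G Eo \<Gamma> \<longleftrightarrow>
            \<not> (\<exists>q. (q, {}) \<in> weak_anonymity.Cc_reachable G Eo Euo \<Gamma>))
       \<and> (\<forall>K. weak_anonymity.K_step_weakly_anonymous G Eo \<Gamma> K \<longleftrightarrow>
            \<not> (\<exists>q. (q, {}) \<in> weak_anonymity.Cc_reachable_within G Eo Euo \<Gamma> K))"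
proof -
  interpret finite_weak_anonymity G Eo Euo \<Gamma>
    using assms by unfold_locales
  have "infinite_step_weakly_anonymous \<longleftrightarrow> \<not> (\<exists>q. (q, {}) \<in> Cc_reachable)"
    using anonymous_iff[of "\<lambda>_. True"] empty_reachable_iff[of "\<lambda>_. True"]
    by (simp add: infinite_step_weakly_anonymous_def Cc_reachable_def)
  moreover have "K_step_weakly_anonymous K \<longleftrightarrow> \<not> (\<exists>q. (q, {}) \<in> Cc_reachable_within K)" for K
    using anonymous_iff[of "\<lambda>\<beta>. length \<beta> \<le> K"] empty_reachable_iff[of "\<lambda>\<beta>. length \<beta> \<le> K"]
    by (simp add: K_step_weakly_anonymous_def Cc_reachable_within_def)
  ultimately show ?thesis by blast
qed

end
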